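(* Let $P$ be a non-empty convex polytope and let $k\ge 1$ be an integer. Then $$\mathrm{rk}_+(P\times\Delta_k)\ =\ \mathrm{rk}_+(P)+k+1.$$
   Context: $\Delta_k$ denotes the $k$-dimensional simplex. The extension complexity (nonnegative rank) $\mathrm{rk}_+(P)$ of a convex polytope $P$ is the minimal number of facets (equivalently, of describing linear inequalities, not counting equations) of a polytope $\widehat{P}$ (of any dimension) such that $P$ is the image of $\widehat{P}$ under a linear projection (affine map). Facets are non-empty faces of codimension one; in particular a single point has no facets and $\mathrm{rk}_+(\text{point})=0$. *)

theory Defs
  imports "HOL-Analysis.Analysis" "HOL-Analysis.Finite_Function_Topology"
begin

text \<open>
  The polytopes of which a given polytope is a projection may have arbitrary dimension, so they
  cannot be taken in one fixed Euclidean space. They are taken in the space \<^typ>\<open>nat \<Rightarrow>\<^sub>0 real\<close> of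
  finitely supported real sequences, the union of all coordinate spaces of finite dimension.
  The library's \<^const>\<open>polytope\<close> and \<^term>\<open>(face_of)\<close> are available there, but
  \<^const>\<open>aff_dim\<close> and hence \<^term>\<open>(facet_of)\<close> are restricted to Euclidean spaces. The next two
  definitions repeat those of the library for arbitrary real vector spaces.
\<close>

text \<open>Only meaningful for sets whose affine hull is finite-dimensional; the empty set has dimension
  \<open>-1\<close>. The condition \<^term>\<open>finite B\<close> is needed since \<^term>\<open>card B = 0\<close> for infinite \<open>B\<close>.\<close>

definition affine_dim :: "'a::real_vector set \<Rightarrow> int" where
  "affine_dim S = (SOME d. \<exists>B. finite B \<and> affine hull B = affine hull S \<and>
                              \<not> affine_dependent B \<and> int (card B) = d + 1)"

definition facets :: "'a::real_vector set \<Rightarrow> 'a set set" where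
  "facets S = {F. F face_of S \<and> F \<noteq> {} \<and> affine_dim F = affine_dim S - 1}"

lemma affine_dim_eq_aff_dim: "affine_dim S = aff_dim S"
  for S :: "'a::euclidean_space set"
proof -
  have "(\<exists>B. finite B \<and> affine hull B = affine hull S \<and> \<not> affine_dependent B \<and> int (card B) = d + 1)
    \<longleftrightarrow> (\<exists>B. affine hull B = affine hull S \<and> \<not> affine_dependent B \<and> int (card B) = d + 1)" for d
    using aff_independent_finite by blast
  then show ?thesis
    by (simp add: affine_dim_def aff_dim_def)
qed

lemma facets_eq_facet_of: "facets S = {F. F facet_of S}"
  for S :: "'a::euclidean_space set"
  by (simp add: facets_def facet_of_def affine_dim_eq_aff_dim)

definition affine_image_of :: "'b::real_vector set \<Rightarrow> 'a::real_vector set \<Rightarrow> bool" where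
  "affine_image_of P Q \<longleftrightarrow> (\<exists>f c. linear f \<and> P = (\<lambda>x. f x + c) ` Q)"

definition extension_complexity :: "'a::real_vector set \<Rightarrow> nat" where
  "extension_complexity P =
     (LEAST n. \<exists>Q :: (nat \<Rightarrow>\<^sub>0 real) set.
        polytope Q \<and> affine_image_of P Q \<and> finite (facets Q) \<and> card (facets Q) = n)"

text \<open>Every polytope has an extension in \<^typ>\<open>nat \<Rightarrow>\<^sub>0 real\<close>, namely a copy of itself.\<close>

lemma extension_exists:
  fixes P :: "'a::euclidean_space set"
  assumes "polytope P"
  shows "\<exists>Q :: (nat \<Rightarrow>\<^sub>0 real) set. polytope Q \<and> affine_image_of P Q"
proof -
  obtain h :: "'a \<Rightarrow> nat" where h: "inj_on h Basis"
    using finite_imp_inj_to_nat_seg[OF finite_Basis] by blast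
  define g :: "'a \<Rightarrow> nat \<Rightarrow>\<^sub>0 real" where "g x = (\<Sum>b\<in>Basis. Poly_Mapping.single (h b) (x \<bullet> b))" for x
  define f :: "(nat \<Rightarrow>\<^sub>0 real) \<Rightarrow> 'a" where "f p = (\<Sum>b\<in>Basis. Poly_Mapping.lookup p (h b) *\<^sub>R b)" for p
  have lookup_scaleR: "Poly_Mapping.lookup (r *\<^sub>R p) i = r * Poly_Mapping.lookup p i"
    for r i and p :: "nat \<Rightarrow>\<^sub>0 real"
    by (simp add: scaleR_poly_mapping_def lookup_Abs_poly_mapping)
  have single_scaleR: "Poly_Mapping.single i (r * x) = r *\<^sub>R Poly_Mapping.single i x"
    for r x :: real and i :: nat
    by (rule poly_mapping_eqI) (simp add: lookup_scaleR lookup_single when_def)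
  have "linear g"
    by (rule linearI)
      (simp_all add: g_def inner_add_left single_add sum.distrib single_scaleR scaleR_sum_right)
  have "linear f"
    by (rule linearI)
      (simp_all add: f_def lookup_add lookup_scaleR scaleR_add_left sum.distrib scaleR_sum_right)
  have "Poly_Mapping.lookup (g x) (h b) = x \<bullet> b" if "b \<in> Basis" for x b
  proof -
    have "Poly_Mapping.lookup (g x) (h b) = (\<Sum>c\<in>Basis. if c = b then x \<bullet> b else 0)"
      unfolding g_def lookup_sum
      by (rule sum.cong) (use h that in \<open>auto simp: lookup_single when_def inj_on_def\<close>)
    then show ?thesis using that by simp
  qed
  then have fg: "f (g x) = x" for x
    by (simp add: f_def euclidean_representation)
  have "polytope (g ` P)"
    using assms \<open>linear g\<close> by (rule polytope_linear_image[rotated])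
  moreover have "P = (\<lambda>x. f x + 0) ` (g ` P)"
    by (simp add: image_image fg)
  ultimately show ?thesis
    using \<open>linear f\<close> unfolding affine_image_of_def by blast
qed

end

theory Submission
  imports Defs
begin

text \<open>
  Upper bound: if \<open>Q\<close> projects onto \<open>P\<close>, then \<open>Q \<times> D\<close> projects onto \<open>P \<times> D\<close>, and every facet of the
  product is a facet of one factor times the other factor.

  Lower bound: let \<open>Q\<close> be an extension of \<open>P \<times> D\<close> with the least number of facets. For each vertex \<open>v\<close>
  of \<open>D\<close> let \<open>R v\<close> and \<open>G v\<close> be the faces of \<open>Q\<close> above \<open>P \<times> {v}\<close> and above \<open>P\<close> times the facet of \<open>D\<close>
  opposite to \<open>v\<close>. A facet of \<open>Q\<close> containing \<open>G u\<close> and \<open>G v\<close> with \<open>u \<noteq> v\<close> contains all \<open>R w\<close>, so it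
  would be a smaller extension; thus the sets \<open>N v\<close> of facets containing \<open>G v\<close> are disjoint, and they
  are not empty. The face \<open>R i\<close> is an extension of \<open>P\<close>, and its facets are intersections with facets
  of \<open>Q\<close> that neither contain nor miss \<open>R i\<close>. The facets in \<open>N v\<close>, \<open>v \<noteq> i\<close>, contain \<open>R i\<close>. If some
  \<open>N j\<close> has two elements, then choosing \<open>i \<noteq> j\<close> excludes \<open>k + 1\<close> facets in this way. Otherwise
  \<open>G i\<close> is itself a facet, it misses \<open>R i\<close>, and it is the \<open>(k + 1)\<close>-st excluded facet.

  These arguments need that a face of a polytope is the intersection of the facets containing it,
  which the library only has in Euclidean spaces. In a real vector space it follows from the
  generation of finitely generated pointed cones by their extreme rays.
\<close>

subsection \<open>Faces in real vector spaces\<close>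

text \<open>Collecting the coefficients of an affine combination by sign gives
  \<open>x + N n = (1 + N) p\<close> with \<open>p\<close> and \<open>n\<close> in \<open>F\<close>.
  For \<open>N > 0\<close>, either \<open>x = n\<close> or \<open>p\<close> lies strictly between
  \<open>x\<close> and \<open>n\<close>, and the face property puts \<open>x\<close> in
  \<open>F\<close>; for \<open>N = 0\<close> one has \<open>x = p\<close>.\<close>

lemma mem_face_of_affine_hull:
  fixes S :: "'a::real_vector set"
  assumes "F face_of S" "x \<in> S" "x \<in> affine hull F"
  shows "x \<in> F"
proof -
  have F: "convex F" "F \<subseteq> S" using assms(1) by (auto simp: face_of_def)
  obtain T u where T: "finite T" "T \<subseteq> F" and u: "sum u T = 1" "(\<Sum>v\<in>T. u v *\<^sub>R v) = x"
    using assms(3) unfolding affine_hull_explicit by blast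
  define A where "A = {v\<in>T. u v \<ge> 0}"
  define B where "B = {v\<in>T. u v < 0}"
  have AB: "T = A \<union> B" "A \<inter> B = {}" "finite A" "finite B" "A \<subseteq> F" "B \<subseteq> F"
    using T by (auto simp: A_def B_def)
  define N where "N = (\<Sum>v\<in>B. - u v)"
  have "sum u A - N = 1"
    using u(1) AB by (simp add: N_def sum.union_disjoint sum_negf)
  then have sA: "sum u A = 1 + N" by simp
  have xA: "x = (\<Sum>v\<in>A. u v *\<^sub>R v) - (\<Sum>v\<in>B. (- u v) *\<^sub>R v)"
    using u(2) AB by (simp add: sum.union_disjoint sum_negf)
  have N0: "N \<ge> 0" unfolding N_def by (rule sum_nonneg) (auto simp: B_def)
  define p where "p = (\<Sum>v\<in>A. (u v / (1 + N)) *\<^sub>R v)"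
  have p: "p \<in> F"
    unfolding p_def
    by (rule convex_sum[OF AB(3) F(1)])
      (use sA N0 AB(5) in \<open>auto simp: A_def sum_divide_distrib[symmetric]\<close>)
  have p': "(\<Sum>v\<in>A. u v *\<^sub>R v) = (1 + N) *\<^sub>R p"
    using N0 by (simp add: p_def scaleR_sum_right)
  show ?thesis
  proof (cases "N = 0")
    case True
    then have "\<forall>v\<in>B. - u v = 0"
      unfolding N_def using sum_nonneg_eq_0_iff[OF AB(4), of "\<lambda>v. - u v"] by (auto simp: B_def)
    then have "B = {}" by (auto simp: B_def)
    then have "x = p" using xA p' True by simp
    with p show ?thesis by simp
  next
    case False
    with N0 have N: "N > 0" by simp
    define n where "n = (\<Sum>v\<in>B. (- u v / N) *\<^sub>R v)"
    have n: "n \<in> F"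
      unfolding n_def
    proof (rule convex_sum[OF AB(4) F(1)])
      show "(\<Sum>v\<in>B. - u v / N) = 1"
        using N unfolding sum_divide_distrib[symmetric] N_def by simp
    qed (use N AB(6) in \<open>auto simp: B_def divide_nonpos_pos\<close>)
    have n': "(\<Sum>v\<in>B. (- u v) *\<^sub>R v) = N *\<^sub>R n"
      using N by (simp add: n_def scaleR_sum_right)
    have xpn: "x + N *\<^sub>R n = (1 + N) *\<^sub>R p" using xA p' n' by simp
    have "p = (1 / (1 + N)) *\<^sub>R ((1 + N) *\<^sub>R p)" using N by simp
    also have "\<dots> = (1 / (1 + N)) *\<^sub>R x + (N / (1 + N)) *\<^sub>R n"
      by (simp add: xpn[symmetric] scaleR_add_right)
    also have "1 / (1 + N) = 1 - N / (1 + N)" using N by (simp add: field_simps)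
    finally have peq: "p = (1 - N / (1 + N)) *\<^sub>R x + (N / (1 + N)) *\<^sub>R n" .
    show ?thesis
    proof (cases "x = n")
      case False
      have "p \<in> open_segment x n"
        unfolding in_segment using False peq N by (auto intro!: exI[of _ "N / (1 + N)"])
      with face_ofD[OF assms(1) _ assms(2) _ p] n F(2) show ?thesis by blast
    qed (use n in simp)
  qed
qed

text \<open>Grouping all terms but that of \<open>w\<close> and normalising their weights gives a
  point \<open>z\<close> of \<open>S\<close>. The combination lies strictly between \<open>w\<close>
  and \<open>z\<close>, so the face property applies. The case \<open>u w = 1\<close> is separate
  because the normalising factor is \<open>1 - u w\<close>.\<close>

lemma face_of_convex_comb:
  fixes S :: "'a::real_vector set"
  assumes F: "F face_of S" and S: "convex S" and V: "finite V" "V \<subseteq> S"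
    and u: "\<And>v. v \<in> V \<Longrightarrow> 0 \<le> u v" "sum u V = 1" "(\<Sum>v\<in>V. u v *\<^sub>R v) \<in> F"
    and w: "w \<in> V" "u w > 0"
  shows "w \<in> F"
proof -
  let ?x = "\<Sum>v\<in>V. u v *\<^sub>R v"
  have s: "sum u V = u w + sum u (V - {w})" using V w by (simp add: sum.remove)
  have x: "?x = u w *\<^sub>R w + (\<Sum>v\<in>V-{w}. u v *\<^sub>R v)" using V w by (simp add: sum.remove)
  have rest: "sum u (V - {w}) \<ge> 0" by (rule sum_nonneg) (use u in auto)
  show ?thesis
  proof (cases "u w = 1")
    case True
    then have "sum u (V - {w}) = 0" using s u(2) by simp
    then have "\<forall>v\<in>V-{w}. u v = 0"
      using sum_nonneg_eq_0_iff[of "V - {w}" u] V u(1) by auto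
    then have "?x = w" using x True by simp
    then show ?thesis using u(3) by simp
  next
    case False
    define r where "r = 1 - u w"
    have r: "r > 0" "r < 1" "sum u (V - {w}) = r"
      using s u(2) rest False w by (auto simp: r_def)
    define z where "z = (\<Sum>v\<in>V-{w}. (u v / r) *\<^sub>R v)"
    have z: "z \<in> S"
      unfolding z_def
      by (rule convex_sum[OF _ S]) (use V u r in \<open>auto simp: sum_divide_distrib[symmetric]\<close>)
    have xz: "?x = (1 - r) *\<^sub>R w + r *\<^sub>R z"
      using r unfolding x z_def r_def[symmetric] by (simp add: scaleR_sum_right r_def)
    show ?thesis
    proof (cases "w = z")
      case True
      then have "?x = w" using xz by (simp add: scaleR_left_distrib[symmetric])
      then show ?thesis using u(3) by simp
    next
      case False
      then have "?x \<in> open_segment w z" unfolding in_segment using xz r by blast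
      then show ?thesis using face_ofD[OF F _ _ z u(3)] w V by blast
    qed
  qed
qed

text \<open>A convex combination that lies in a face gives positive weight only to generators in
  that face.\<close>

lemma face_of_convex_hull_finite:
  fixes V :: "'a::real_vector set"
  assumes V: "finite V" and F: "F face_of convex hull V"
  shows "F = convex hull (V \<inter> F)"
proof
  show "convex hull (V \<inter> F) \<subseteq> F"
    using face_of_imp_convex[OF F] by (simp add: hull_minimal)
  show "F \<subseteq> convex hull (V \<inter> F)"
  proof
    fix x assume x: "x \<in> F"
    then have "x \<in> convex hull V" using F face_of_imp_subset by blast
    then obtain u where u: "\<forall>v\<in>V. 0 \<le> u v" "sum u V = 1" "(\<Sum>v\<in>V. u v *\<^sub>R v) = x"
      unfolding convex_hull_finite[OF V] by blast
    have *: "v \<in> F" if "v \<in> V" "u v > 0" for v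
      using face_of_convex_comb[OF F convex_convex_hull V hull_subset, of u v] u x that by auto
    then have z: "\<forall>v\<in>V - V \<inter> F. u v = 0" using u(1) by force
    have "sum u (V \<inter> F) = 1" "(\<Sum>v\<in>V\<inter>F. u v *\<^sub>R v) = x"
      using sum.mono_neutral_right[OF V, of "V \<inter> F" u] 
        sum.mono_neutral_right[OF V, of "V \<inter> F" "\<lambda>v. u v *\<^sub>R v"] z u by auto
    then show "x \<in> convex hull (V \<inter> F)"
      using u(1) V unfolding convex_hull_finite[OF finite_Int[OF disjI1, OF V]] by blast
  qed
qed

lemma polytope_face:
  fixes Q :: "'a::real_vector set"
  assumes "polytope Q" "F face_of Q"
  shows "polytope F"
proof -
  obtain V where "finite V" "Q = convex hull V" using assms(1) unfolding polytope_def by blast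
  with face_of_convex_hull_finite[of V F] assms(2) show ?thesis
    unfolding polytope_def by (metis finite_Int)
qed

lemma finite_faces_polytope:
  fixes Q :: "'a::real_vector set"
  assumes "polytope Q"
  shows "finite {F. F face_of Q}"
proof -
  obtain V where V: "finite V" "Q = convex hull V" using assms unfolding polytope_def by blast
  have "{F. F face_of Q} \<subseteq> (\<lambda>W. convex hull W) ` Pow V"
    using face_of_convex_hull_finite[OF V(1)] V(2) by blast
  then show ?thesis using V(1) finite_subset by blast
qed

section \<open>Faces of products and preimages of faces\<close>

lemma face_of_Times_cases:
  fixes S :: "'a::real_vector set" and S' :: "'b::real_vector set"
  assumes C: "C face_of S \<times> S'"
  obtains F F' where "F face_of S" "F' face_of S'" "C = F \<times> F'"
proof
  have sub: "C \<subseteq> S \<times> S'" and conv: "convex C" using C by (auto simp: face_of_def)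
  show 1: "fst ` C face_of S"
    unfolding face_of_def
  proof (intro conjI ballI impI)
    show "fst ` C \<subseteq> S" using sub by auto
    show "convex (fst ` C)" using conv by (simp add: convex_linear_image linear_fst)
    fix a b x assume "a \<in> S" "b \<in> S" "x \<in> fst ` C" "x \<in> open_segment a b"
    then obtain x' where "(x, x') \<in> C" by auto
    \<comment> \<open>A segment in one factor is lifted to the product by freezing the other
      coordinate.\<close>
    moreover have "(x, x') \<in> open_segment (a, x') (b, x')"
      using \<open>x \<in> open_segment a b\<close> by (auto simp: in_segment algebra_simps scaleR_left_distrib[symmetric])
    ultimately have "(a, x') \<in> C \<and> (b, x') \<in> C"
      using face_ofD[OF C] sub \<open>a \<in> S\<close> \<open>b \<in> S\<close> by blast
    then show "a \<in> fst ` C" "b \<in> fst ` C" by force+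
  qed
  show 2: "snd ` C face_of S'"
    unfolding face_of_def
  proof (intro conjI ballI impI)
    show "snd ` C \<subseteq> S'" using sub by auto
    show "convex (snd ` C)" using conv by (simp add: convex_linear_image linear_snd)
    fix a b x assume "a \<in> S'" "b \<in> S'" "x \<in> snd ` C" "x \<in> open_segment a b"
    then obtain x' where "(x', x) \<in> C" by auto
    moreover have "(x', x) \<in> open_segment (x', a) (x', b)"
      using \<open>x \<in> open_segment a b\<close> by (auto simp: in_segment algebra_simps scaleR_left_distrib[symmetric])
    ultimately have "(x', a) \<in> C \<and> (x', b) \<in> C"
      using face_ofD[OF C] sub \<open>a \<in> S'\<close> \<open>b \<in> S'\<close> by blast
    then show "a \<in> snd ` C" "b \<in> snd ` C" by force+
  qed
  have "(a, b') \<in> C" if ab: "(a, a') \<in> C" "(b, b') \<in> C" for a a' b b'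
  proof (cases "(a, b') = (b, a')")
    case False
    \<comment> \<open>the rectangle with diagonal \<open>(a, a')\<close>, \<open>(b, b')\<close> has the same midpoint as its other diagonal\<close>
    let ?m = "(1/2) *\<^sub>R (a, a') + (1/2) *\<^sub>R (b, b')"
    have "?m \<in> C" using convexD[OF conv ab, of "1/2" "1/2"] by simp
    moreover have "?m \<in> open_segment (a, b') (b, a')"
      unfolding in_segment using False by (intro conjI exI[of _ "1/2"]) (auto simp: algebra_simps)
    ultimately show ?thesis using face_ofD[OF C] sub ab by blast
  qed (use that in auto)
  then show "C = fst ` C \<times> snd ` C" by force
qed

text \<open>An affine map sends an open segment to an open segment or collapses it to a point; in
  both cases membership of the image point in \<open>F\<close> passes to the images of the
  endpoints. Faces of a projection thus lift to faces of the extension.\<close>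

lemma face_of_vimage_affine:
  fixes f :: "'a::real_vector \<Rightarrow> 'b::real_vector"
  assumes f: "linear f" and S: "convex S" "(\<lambda>x. f x + c) ` S \<subseteq> T" and F: "F face_of T"
  shows "{x\<in>S. f x + c \<in> F} face_of S"
proof -
  have cv: "f ((1 - t) *\<^sub>R a + t *\<^sub>R b) + c = (1 - t) *\<^sub>R (f a + c) + t *\<^sub>R (f b + c)" for a b t
    by (simp add: linear_add[OF f] linear_scale[OF f]) (simp add: algebra_simps)
  have convF: "convex F" using F face_of_imp_convex by blast
  show ?thesis
    unfolding face_of_def
  proof (intro conjI ballI impI)
    show "convex {x\<in>S. f x + c \<in> F}"
      unfolding convex_alt
    proof (intro ballI allI impI)
      fix x y and t :: real
      assume "x \<in> {x\<in>S. f x + c \<in> F}" "y \<in> {x\<in>S. f x + c \<in> F}" "0 \<le> t \<and> t \<le> 1"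
      then show "(1 - t) *\<^sub>R x + t *\<^sub>R y \<in> {x\<in>S. f x + c \<in> F}"
        using S(1) convF cv unfolding convex_alt by auto
    qed
    have "a \<in> {x\<in>S. f x + c \<in> F} \<and> b \<in> {x\<in>S. f x + c \<in> F}"
      if ab: "a \<in> S" "b \<in> S" "x \<in> {x\<in>S. f x + c \<in> F}" "x \<in> open_segment a b" for a b x
    proof -
      obtain t where t: "0 < t" "t < 1" "x = (1 - t) *\<^sub>R a + t *\<^sub>R b"
        using ab(4) by (auto simp: in_segment)
      have x: "f x + c = (1 - t) *\<^sub>R (f a + c) + t *\<^sub>R (f b + c)" "f x + c \<in> F"
        using cv t ab by auto
      show ?thesis
      proof (cases "f a + c = f b + c")
        case True
        then have "f x + c = f a + c" using x by (simp add: scaleR_left_distrib[symmetric])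
        then show ?thesis using True x ab by simp
      next
        case False
        then have "f x + c \<in> open_segment (f a + c) (f b + c)"
          unfolding in_segment using t x by blast
        then show ?thesis using face_ofD[OF F _ _ _ x(2)] ab S(2) by blast
      qed
    qed
    then show "a \<in> {x\<in>S. f x + c \<in> F}" "b \<in> {x\<in>S. f x + c \<in> F}"
      if "a \<in> S" "b \<in> S" "x \<in> {x\<in>S. f x + c \<in> F}" "x \<in> open_segment a b" for a b x
      using that by blast+
  qed auto
qed

subsection \<open>Affine dimension and facets\<close>

text \<open>Steinitz exchange for differences: with base points \<open>a\<close> in \<open>B\<close>
  and \<open>t\<close> in \<open>T\<close>, the vectors \<open>b - a\<close> are independent and lie
  in the span of the vectors \<open>s - t\<close> with \<open>s\<close> in \<open>T\<close>.\<close>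

lemma affine_independent_card_le:
  fixes B :: "'a::real_vector set"
  assumes B: "\<not> affine_dependent B" "B \<subseteq> affine hull T" and T: "finite T"
  shows "finite B \<and> card B \<le> card T"
proof (cases "B = {}")
  case False
  then obtain a where a: "a \<in> B" by blast
  then obtain t where t: "t \<in> T" using B(2) by fastforce
  have hull: "affine hull T = (\<lambda>x. t + x) ` span ((\<lambda>x. -t + x) ` (T - {t}))"
    using affine_hull_span2[OF t] .
  let ?B = "(\<lambda>x. -a + x) ` (B - {a})"
  have "?B \<subseteq> span ((\<lambda>x. -t + x) ` (T - {t}))"
  proof
    fix y assume "y \<in> ?B"
    then obtain b where b: "b \<in> B" "y = b - a" by auto
    have "b \<in> (\<lambda>x. t + x) ` span ((\<lambda>x. -t + x) ` (T - {t}))"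
      and "a \<in> (\<lambda>x. t + x) ` span ((\<lambda>x. -t + x) ` (T - {t}))"
      using a b(1) B(2) hull by (metis subsetD)+
    then obtain u v where "b = t + u" "a = t + v"
      and uv: "u \<in> span ((\<lambda>x. -t + x) ` (T - {t}))" "v \<in> span ((\<lambda>x. -t + x) ` (T - {t}))"
      by (elim imageE)
    then have "y = u - v" using b by simp
    then show "y \<in> span ((\<lambda>x. -t + x) ` (T - {t}))" using uv by (simp add: span_diff)
  qed
  moreover have "independent ?B" using B(1) affine_dependent_iff_dependent2[OF a] by simp
  ultimately have *: "finite ?B \<and> card ?B \<le> card ((\<lambda>x. -t + x) ` (T - {t}))"
    using independent_span_bound[of "(\<lambda>x. -t + x) ` (T - {t})" ?B] T by simp
  have inj: "inj_on (\<lambda>x. -a + x) (B - {a})" by (auto simp: inj_on_def)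
  have "finite (B - {a})" using * finite_image_iff[OF inj] by simp
  then have fin: "finite B" by simp
  have "card (B - {a}) \<le> card ((\<lambda>x. -t + x) ` (T - {t}))" using * card_image[OF inj] by simp
  also have "\<dots> \<le> card (T - {t})" using T by (simp add: card_image_le)
  finally have "card B - 1 \<le> card T - 1" using a t fin T by simp
  \<comment> \<open>The subtractions above are truncated, so an empty \<open>T\<close> has to be
    excluded.\<close>
  moreover have "card T > 0" using t T by (auto simp: card_gt_0_iff)
  ultimately show ?thesis using fin by linarith
qed auto

text \<open>Two affinely independent finite sets with the same affine hull bound each other's
  cardinality, so only one value satisfies the condition under \<open>SOME\<close>.\<close>

lemma affine_dim_eq:
  fixes B :: "'a::real_vector set"
  assumes "finite B" "affine hull B = affine hull S" "\<not> affine_dependent B"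
  shows "affine_dim S = int (card B) - 1"
  unfolding affine_dim_def
proof (rule some_equality)
  show "\<exists>B'. finite B' \<and> affine hull B' = affine hull S \<and> \<not> affine_dependent B' \<and>
          int (card B') = int (card B) - 1 + 1"
    using assms by auto
next
  fix d assume "\<exists>B'. finite B' \<and> affine hull B' = affine hull S \<and> \<not> affine_dependent B' \<and>
          int (card B') = d + 1"
  then obtain B' where B': "finite B'" "affine hull B' = affine hull S" "\<not> affine_dependent B'"
      "int (card B') = d + 1" by blast
  have "B' \<subseteq> affine hull B" "B \<subseteq> affine hull B'"
    using assms(2) B'(2) hull_subset[of B affine] hull_subset[of B' affine] by auto
  then have "card B' = card B"
    using affine_independent_card_le[OF B'(3) _ assms(1)] affine_independent_card_le[OF assms(3) _ B'(1)]
    by force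
  then show "d = int (card B) - 1" using B'(4) by simp
qed

lemma finite_affine_basis:
  fixes S :: "'a::real_vector set"
  assumes "finite T" "S \<subseteq> affine hull T"
  obtains B where "finite B" "B \<subseteq> S" "\<not> affine_dependent B" "affine hull B = affine hull S"
proof -
  obtain B where "B \<subseteq> S" "\<not> affine_dependent B" "affine hull S = affine hull B"
    using affine_basis_exists by blast
  with affine_independent_card_le[of B T] assms that show ?thesis by auto
qed

lemma affine_independent_insert:
  fixes B :: "'a::real_vector set"
  assumes B: "\<not> affine_dependent B" and w: "w \<notin> affine hull B"
  shows "\<not> affine_dependent (insert w B)"
proof (cases "B = {}")
  case False
  then obtain a where a: "a \<in> B" by blast
  have wa: "w \<noteq> a" using w a hull_inc by metis
  have ind: "independent ((\<lambda>x. -a + x) ` (B - {a}))"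
    using B affine_dependent_iff_dependent2[OF a] by simp
  have hull: "affine hull B = (\<lambda>x. a + x) ` span ((\<lambda>x. -a + x) ` (B - {a}))"
    using affine_hull_span2[OF a] .
  have "-a + w \<notin> span ((\<lambda>x. -a + x) ` (B - {a}))"
  proof
    assume "-a + w \<in> span ((\<lambda>x. -a + x) ` (B - {a}))"
    then have "a + (-a + w) \<in> affine hull B" unfolding hull by (rule imageI)
    then show False using w by simp
  qed
  then have "independent (insert (-a + w) ((\<lambda>x. -a + x) ` (B - {a})))"
    using ind independent_insertI by blast
  moreover have "(\<lambda>x. -a + x) ` (insert w B - {a}) = insert (-a + w) ((\<lambda>x. -a + x) ` (B - {a}))"
    using wa by auto
  ultimately show ?thesis
    using affine_dependent_iff_dependent2[of a "insert w B"] a by auto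
qed simp

lemma affine_hull_insert_cong:
  assumes "affine hull B = affine hull F"
  shows "affine hull (insert w B) = affine hull (insert w F)"
proof -
  have "affine hull (insert w X) \<subseteq> affine hull (insert w Y)" if "affine hull X = affine hull Y" for X Y
  proof (rule hull_minimal)
    have "X \<subseteq> affine hull Y" using that hull_subset[of X affine] by simp
    also have "\<dots> \<subseteq> affine hull (insert w Y)" by (rule hull_mono) auto
    finally show "insert w X \<subseteq> affine hull (insert w Y)" by (simp add: hull_inc)
  qed simp
  with assms show ?thesis by blast
qed

lemma polytope_affine_hull:
  fixes Q :: "'a::real_vector set"
  assumes "polytope Q"
  obtains T where "finite T" "Q \<subseteq> affine hull T"
  using assms convex_hull_subset_affine_hull unfolding polytope_def by blast

text \<open>A face contains all points of \<open>Q\<close> in its affine hull, so an affine basis of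
  \<open>F\<close> stays independent when a point \<open>w\<close> of \<open>Q - F\<close> is added.
  Codimension one means that this already gives a basis for \<open>Q\<close>.\<close>

lemma facets_iff_affine_hull:
  fixes Q :: "'a::real_vector set"
  assumes Q: "polytope Q"
  shows "F \<in> facets Q \<longleftrightarrow> F face_of Q \<and> F \<noteq> {} \<and> (\<exists>w\<in>Q-F. Q \<subseteq> affine hull (insert w F))"
proof -
  obtain T where T: "finite T" "Q \<subseteq> affine hull T" using polytope_affine_hull[OF Q] .
  obtain BQ where BQ: "finite BQ" "BQ \<subseteq> Q" "\<not> affine_dependent BQ" "affine hull BQ = affine hull Q"
    using finite_affine_basis[OF T] .
  have dQ: "affine_dim Q = int (card BQ) - 1" using affine_dim_eq BQ by blast
  have "affine_dim F = affine_dim Q - 1 \<longleftrightarrow> (\<exists>w\<in>Q-F. Q \<subseteq> affine hull (insert w F))"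
    if F: "F face_of Q" "F \<noteq> {}"
  proof -
    have FQ: "F \<subseteq> Q" using F face_of_imp_subset by blast
    obtain B where B: "finite B" "B \<subseteq> F" "\<not> affine_dependent B" "affine hull B = affine hull F"
      using finite_affine_basis[OF T(1), of F] T(2) FQ by blast
    have dF: "affine_dim F = int (card B) - 1" using affine_dim_eq B by blast
    have wB: "w \<notin> affine hull B" if "w \<in> Q - F" for w
      using that mem_face_of_affine_hull[OF F(1)] B(4) by blast
    have hullw: "affine hull (insert w B) = affine hull (insert w F)" for w
      using affine_hull_insert_cong[OF B(4)] .
    have cardw: "card (insert w B) = card B + 1" if "w \<in> Q - F" for w
      using that B(1,2) by (subst card_insert_disjoint) auto
    show ?thesis
    proof
      assume eq: "affine_dim F = affine_dim Q - 1"
      then have "F \<noteq> Q" by auto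
      then obtain w where w: "w \<in> Q - F" using FQ by blast
      have ind: "\<not> affine_dependent (insert w B)"
        using affine_independent_insert[OF B(3) wB[OF w]] .
      \<comment> \<open>Otherwise \<open>B\<close>, \<open>w\<close> and \<open>y\<close> would form
        an independent set of \<open>card B + 2\<close> points in the hull of \<open>BQ\<close>,
        while \<open>BQ\<close> has \<open>card B + 1\<close> points.\<close>
      have "y \<in> affine hull (insert w B)" if y: "y \<in> Q" for y
      proof (rule ccontr)
        assume ny: "y \<notin> affine hull (insert w B)"
        have "insert y (insert w B) \<subseteq> affine hull BQ"
          using y w B(2) FQ hull_subset[of Q affine] BQ(4) by auto
        then have "card (insert y (insert w B)) \<le> card BQ"
          using affine_independent_card_le[OF affine_independent_insert[OF ind ny] _ BQ(1)] by simp
        moreover have "y \<notin> insert w B" using ny hull_inc by metis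
        ultimately have "card (insert w B) + 1 \<le> card BQ" using B(1) by simp
        with cardw[OF w] eq dF dQ show False by simp
      qed
      then show "\<exists>w\<in>Q-F. Q \<subseteq> affine hull (insert w F)" using w hullw by blast
    next
      assume "\<exists>w\<in>Q-F. Q \<subseteq> affine hull (insert w F)"
      then obtain w where w: "w \<in> Q - F" "Q \<subseteq> affine hull (insert w F)" by blast
      have "affine hull (insert w B) = affine hull Q"
      proof
        show "affine hull (insert w B) \<subseteq> affine hull Q" by (rule hull_mono) (use w B FQ in auto)
        show "affine hull Q \<subseteq> affine hull (insert w B)"
          by (rule hull_minimal) (use w hullw in auto)
      qed
      then have "affine_dim Q = int (card (insert w B)) - 1"
        using affine_dim_eq affine_independent_insert[OF B(3) wB[OF w(1)]] B(1) by blast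
      then show "affine_dim F = affine_dim Q - 1" using cardw[OF w(1)] dF by simp
    qed
  qed
  then show ?thesis by (auto simp: facets_def)
qed

section \<open>Enlarging a face while avoiding a point\<close>

lemma ex_face_of_avoiding_0:
  fixes Q :: "'a::real_vector set"
  assumes Q: "polytope Q" and H: "H face_of Q" "0 \<in> H" and x: "x \<in> Q" "x \<notin> H"
    and codim: "\<And>w. w \<in> Q \<Longrightarrow> \<not> Q \<subseteq> span (insert w H)"
  shows "\<exists>H'. H' face_of Q \<and> H \<subset> H' \<and> x \<notin> H'"
proof -
  obtain V where V: "finite V" "Q = convex hull V" using Q unfolding polytope_def by blast
  have VQ: "V \<subseteq> Q" using V(2) hull_subset[of V convex] by simp
  have cQ: "convex Q" using V by simp
  have HQ: "H \<subseteq> Q" using H face_of_imp_subset by blast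
  define L where "L = span H"
  have L: "L = affine hull H" using affine_hull_span_0[of H] hull_inc[of 0 H affine] H(2) by (simp add: L_def)
  have QL: "y \<in> H" if "y \<in> Q" "y \<in> L" for y
    using mem_face_of_affine_hull[OF H(1)] that L by blast
  have Ladd: "a + b \<in> L" and Ldiff: "a - b \<in> L" if "a \<in> L" "b \<in> L" for a b
    using that by (simp_all add: L_def span_add span_diff)
  have Lscale: "r *\<^sub>R a \<in> L" if "a \<in> L" for a r
    using that by (simp add: L_def span_scale)
  have L0: "0 \<in> L" by (simp add: L_def span_zero)
  \<comment> \<open>In the quotient by \<open>L\<close> the set \<open>Q\<close> spans a pointed cone of dimension at least 2. \<open>C W\<close> is the
    preimage of the cone generated by \<open>W\<close>; the elements of a minimal generating set \<open>W\<close> span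
    extreme rays, and every extreme ray gives a face of \<open>Q\<close>. Two such faces meet only in \<open>H\<close>, so one of
    them avoids \<open>x\<close>.\<close>
  define C where "C W = {y. \<exists>u. (\<forall>v\<in>W. 0 \<le> u v) \<and> y - (\<Sum>v\<in>W. u v *\<^sub>R v) \<in> L}" for W :: "'a set"
  have "v \<in> C V" if "v \<in> V" for v
  proof -
    have "(\<Sum>a\<in>V. (if a = v then 1 else 0) *\<^sub>R a) = (\<Sum>a\<in>V. if v = a then a else 0)"
      by (rule sum.cong) auto
    then have "(\<Sum>a\<in>V. (if a = v then 1 else 0) *\<^sub>R a) = v"
      using that V(1) by simp
    then show ?thesis unfolding C_def using L0 by (auto intro!: exI[of _ "\<lambda>a. if a = v then 1 else 0"])
  qed
  then have VC: "V \<subseteq> C V" by blast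
  define A where "A = {W. W \<subseteq> V \<and> V \<subseteq> C W}"
  have "finite A" using V(1) by (simp add: A_def)
  moreover have "A \<noteq> {}" using VC by (auto simp: A_def)
  ultimately obtain W where "W \<in> A" and min: "\<forall>W'\<in>A. W' \<subseteq> W \<longrightarrow> W = W'"
    using finite_has_minimal[of A] by blast
  then have W: "W \<subseteq> V" "V \<subseteq> C W" by (auto simp: A_def)
  have CE: "\<exists>u. (\<forall>v\<in>X. 0 \<le> u v) \<and> y - (\<Sum>v\<in>X. u v *\<^sub>R v) \<in> L" if "y \<in> C X" for y X
    using that by (simp add: C_def)
  have fW: "finite W" using W V finite_subset by blast
  \<comment> \<open>A redundant \<open>w\<close> could be replaced in every representation by its
    own representation over \<open>W - {w}\<close>, against the minimality of
    \<open>W\<close>.\<close>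
  have irr: "w \<notin> C (W - {w})" if w: "w \<in> W" for w
  proof
    assume "w \<in> C (W - {w})"
    then obtain u' where u': "\<And>v. v \<in> W - {w} \<Longrightarrow> 0 \<le> u' v" "w - (\<Sum>v\<in>W-{w}. u' v *\<^sub>R v) \<in> L"
      using CE by blast
    have "V \<subseteq> C (W - {w})"
    proof
      fix y assume "y \<in> V"
      then obtain u where u: "\<And>v. v \<in> W \<Longrightarrow> 0 \<le> u v" "y - (\<Sum>v\<in>W. u v *\<^sub>R v) \<in> L"
        using CE[OF subsetD[OF W(2)]] by blast
      have "(y - (\<Sum>v\<in>W. u v *\<^sub>R v)) + u w *\<^sub>R (w - (\<Sum>v\<in>W-{w}. u' v *\<^sub>R v)) \<in> L"
        by (intro Ladd Lscale u(2) u'(2))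
      moreover have "(y - (\<Sum>v\<in>W. u v *\<^sub>R v)) + u w *\<^sub>R (w - (\<Sum>v\<in>W-{w}. u' v *\<^sub>R v))
          = y - (\<Sum>v\<in>W-{w}. (u v + u w * u' v) *\<^sub>R v)"
        using sum.remove[OF fW w, of "\<lambda>v. u v *\<^sub>R v"]
        by (simp add: scaleR_add_left sum.distrib scaleR_right_diff_distrib scaleR_sum_right)
      ultimately have "y - (\<Sum>v\<in>W-{w}. (u v + u w * u' v) *\<^sub>R v) \<in> L" by simp
      moreover have "0 \<le> u v + u w * u' v" if "v \<in> W - {w}" for v
        using that u(1)[of v] u(1)[of w] u'(1)[of v] w by simp
      ultimately show "y \<in> C (W - {w})"
        unfolding C_def by (auto intro!: exI[of _ "\<lambda>v. u v + u w * u' v"])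
    qed
    then have "W - {w} \<in> A" using W(1) by (auto simp: A_def)
    then have "W = W - {w}" using min by blast
    then show False using w by blast
  qed
  have WL: "w \<notin> L" if "w \<in> W" for w
    using irr[OF that] unfolding C_def by (auto dest!: spec[of _ "\<lambda>_. 0"])
  \<comment> \<open>Dividing by the sum of the weights gives a convex combination in
    \<open>Q\<close> and in \<open>L\<close>, hence in \<open>H\<close>. A generator of positive
    weight would then lie in \<open>H\<close>, but no element of \<open>W\<close> lies in
    \<open>L\<close>.\<close>
  have pointed: "u v = 0" if u: "\<And>v. v \<in> W \<Longrightarrow> 0 \<le> u v" "(\<Sum>v\<in>W. u v *\<^sub>R v) \<in> L" and v: "v \<in> W" for u v
  proof (rule ccontr)
    assume nz: "u v \<noteq> 0"
    define s where "s = sum u W"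
    have "u v \<le> s" unfolding s_def using u v fW by (intro member_le_sum) auto
    then have s: "s > 0" using nz u(1)[OF v] by linarith
    have eq: "(\<Sum>v\<in>W. (u v / s) *\<^sub>R v) = (1 / s) *\<^sub>R (\<Sum>v\<in>W. u v *\<^sub>R v)"
      by (simp add: scaleR_sum_right)
    have s1: "(\<Sum>v\<in>W. u v / s) = 1"
      using s by (simp add: s_def sum_divide_distrib[symmetric])
    have "(\<Sum>v\<in>W. (u v / s) *\<^sub>R v) \<in> Q"
      by (rule convex_sum[OF fW cQ s1]) (use u s W VQ in auto)
    then have "(\<Sum>v\<in>W. (u v / s) *\<^sub>R v) \<in> H"
      by (rule QL) (unfold eq, rule Lscale[OF u(2)])
    then have "v \<in> H"
      using face_of_convex_comb[OF H(1) cQ fW, of "\<lambda>v. u v / s" v] s1 W VQ u s v nz by force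
    then show False using WL[OF v] span_base[of v H] by (simp add: L_def)
  qed
  have QC: "Q \<subseteq> C W"
    unfolding V(2)
  proof (rule hull_minimal[OF W(2)])
    show "convex (C W)"
      unfolding convex_def
    proof (intro ballI allI impI)
      fix y z a b assume "y \<in> C W" "z \<in> C W" and ab: "0 \<le> a" "0 \<le> b" "a + b = (1::real)"
      then obtain u u' where u: "\<And>v. v \<in> W \<Longrightarrow> 0 \<le> u v" "y - (\<Sum>v\<in>W. u v *\<^sub>R v) \<in> L"
        and u': "\<And>v. v \<in> W \<Longrightarrow> 0 \<le> u' v" "z - (\<Sum>v\<in>W. u' v *\<^sub>R v) \<in> L"
        using CE by meson
      have "a *\<^sub>R (y - (\<Sum>v\<in>W. u v *\<^sub>R v)) + b *\<^sub>R (z - (\<Sum>v\<in>W. u' v *\<^sub>R v)) \<in> L"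
        by (intro Ladd Lscale u(2) u'(2))
      moreover have "a *\<^sub>R (y - (\<Sum>v\<in>W. u v *\<^sub>R v)) + b *\<^sub>R (z - (\<Sum>v\<in>W. u' v *\<^sub>R v))
          = a *\<^sub>R y + b *\<^sub>R z - (\<Sum>v\<in>W. (a * u v + b * u' v) *\<^sub>R v)"
        by (simp add: scaleR_right_diff_distrib scaleR_sum_right scaleR_add_left sum.distrib)
      ultimately have "a *\<^sub>R y + b *\<^sub>R z - (\<Sum>v\<in>W. (a * u v + b * u' v) *\<^sub>R v) \<in> L" by simp
      moreover have "0 \<le> a * u v + b * u' v" if "v \<in> W" for v
        using that u(1)[of v] u'(1)[of v] ab by simp
      ultimately show "a *\<^sub>R y + b *\<^sub>R z \<in> C W"
        unfolding C_def by (auto intro!: exI[of _ "\<lambda>v. a * u v + b * u' v"])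
    qed
  qed
  \<comment> \<open>Modulo \<open>L\<close>, this is the part of \<open>Q\<close> on the line
    through the origin and \<open>w\<close>.\<close>
  define R where "R w = Q \<inter> span (insert w H)" for w
  have inR: "y \<in> R w \<longleftrightarrow> y \<in> Q \<and> (\<exists>k. y - k *\<^sub>R w \<in> L)" for y w
    by (simp add: R_def L_def span_breakdown_eq)
  have HR: "H \<subseteq> R w" for w using HQ by (auto simp: R_def span_base)
  have wR: "w \<in> R w" if "w \<in> W" for w
    using that W VQ by (auto simp: R_def span_base)
  have face: "R w face_of Q" if w: "w \<in> W" for w
    unfolding face_of_def
  proof (intro conjI ballI impI)
    show "R w \<subseteq> Q" by (auto simp: R_def)
    show "convex (R w)" unfolding R_def
      by (intro convex_Int cQ subspace_imp_convex subspace_span)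
    have *: "a \<in> R w \<and> b \<in> R w" if a: "a \<in> Q" and b: "b \<in> Q" and y: "y \<in> R w" "y \<in> open_segment a b" for a b y
    proof -
      obtain t where t: "0 < t" "t < 1" "y = (1 - t) *\<^sub>R a + t *\<^sub>R b" using y by (auto simp: in_segment)
      obtain k where k: "y - k *\<^sub>R w \<in> L" using y inR by blast
      obtain \<alpha> where \<alpha>: "\<And>v. v \<in> W \<Longrightarrow> 0 \<le> \<alpha> v" "a - (\<Sum>v\<in>W. \<alpha> v *\<^sub>R v) \<in> L"
        using CE[OF subsetD[OF QC a]] by blast
      obtain \<beta> where \<beta>: "\<And>v. v \<in> W \<Longrightarrow> 0 \<le> \<beta> v" "b - (\<Sum>v\<in>W. \<beta> v *\<^sub>R v) \<in> L"
        using CE[OF subsetD[OF QC b]] by blast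
      define \<gamma> where "\<gamma> v = (1 - t) * \<alpha> v + t * \<beta> v" for v
      have \<gamma>0: "0 \<le> \<gamma> v" if "v \<in> W" for v using \<alpha>(1)[OF that] \<beta>(1)[OF that] t by (simp add: \<gamma>_def)
      have "(\<Sum>v\<in>W. \<gamma> v *\<^sub>R v) - k *\<^sub>R w = (y - k *\<^sub>R w) -
          ((1 - t) *\<^sub>R (a - (\<Sum>v\<in>W. \<alpha> v *\<^sub>R v)) + t *\<^sub>R (b - (\<Sum>v\<in>W. \<beta> v *\<^sub>R v)))"
        unfolding t(3) \<gamma>_def
        by (simp add: scaleR_diff_right scaleR_sum_right scaleR_add_left sum.distrib del: scaleR_left_diff_distrib)
      then have "(\<Sum>v\<in>W. \<gamma> v *\<^sub>R v) - k *\<^sub>R w \<in> L" by (simp only: Ladd Ldiff Lscale \<alpha>(2) \<beta>(2) k)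
      then have eq: "(\<gamma> w - k) *\<^sub>R w + (\<Sum>v\<in>W-{w}. \<gamma> v *\<^sub>R v) \<in> L"
        using sum.remove[OF fW w, of "\<lambda>v. \<gamma> v *\<^sub>R v"] by (simp add: scaleR_left_diff_distrib algebra_simps)
      \<comment> \<open>A negative coefficient would allow solving for \<open>w\<close> as a
        non-negative combination of the other generators, contrary to \<open>irr\<close>.\<close>
      have "\<gamma> w - k \<ge> 0"
      proof (rule ccontr)
        assume neg: "\<not> \<gamma> w - k \<ge> 0"
        define r where "r = k - \<gamma> w"
        have r': "r > 0" "\<gamma> w - k = - r" using neg by (simp_all add: r_def)
        have e: "(- 1 / r) *\<^sub>R ((\<gamma> w - k) *\<^sub>R w + (\<Sum>v\<in>W-{w}. \<gamma> v *\<^sub>R v)) = w - (\<Sum>v\<in>W-{w}. (\<gamma> v / r) *\<^sub>R v)"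
          using r' by (simp add: scaleR_right_diff_distrib scaleR_sum_right sum_negf)
        have "w - (\<Sum>v\<in>W-{w}. (\<gamma> v / r) *\<^sub>R v) \<in> L"
          unfolding e[symmetric] by (rule Lscale[OF eq])
        then have "w \<in> C (W - {w})"
          unfolding C_def using \<gamma>0 r' by (auto intro!: exI[of _ "\<lambda>v. \<gamma> v / r"])
        then show False using irr w by blast
      qed
      \<comment> \<open>With all coefficients non-negative, \<open>pointed\<close> makes
        \<open>\<delta>\<close> vanish on \<open>W\<close>. Off \<open>w\<close> this forces
        \<open>\<alpha>\<close> and \<open>\<beta>\<close> to vanish too, since
        \<open>\<gamma>\<close> combines them with positive weights.\<close>
      define \<delta> where "\<delta> v = (if v = w then \<gamma> w - k else \<gamma> v)" for v
      have "(\<Sum>v\<in>W. \<delta> v *\<^sub>R v) = (\<gamma> w - k) *\<^sub>R w + (\<Sum>v\<in>W-{w}. \<gamma> v *\<^sub>R v)"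
        using sum.remove[OF fW w, of "\<lambda>v. \<delta> v *\<^sub>R v"] by (simp add: \<delta>_def)
      then have d0: "\<delta> v = 0" if "v \<in> W" for v
        by (intro pointed[OF _ _ that]) (use eq \<gamma>0 \<open>\<gamma> w - k \<ge> 0\<close> in \<open>auto simp: \<delta>_def\<close>)
      have z: "\<alpha> v = 0 \<and> \<beta> v = 0" if "v \<in> W - {w}" for v
      proof -
        have "(1 - t) * \<alpha> v + t * \<beta> v = 0"
          using that d0[of v] by (auto simp: \<delta>_def \<gamma>_def split: if_splits)
        moreover have "0 \<le> (1 - t) * \<alpha> v" "0 \<le> t * \<beta> v"
          using that \<alpha>(1)[of v] \<beta>(1)[of v] t by auto
        ultimately have "(1 - t) * \<alpha> v = 0 \<and> t * \<beta> v = 0" by linarith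
        then show ?thesis using t by simp
      qed
      have "(\<Sum>v\<in>W. \<alpha> v *\<^sub>R v) = \<alpha> w *\<^sub>R w" "(\<Sum>v\<in>W. \<beta> v *\<^sub>R v) = \<beta> w *\<^sub>R w"
        using sum.remove[OF fW w, of "\<lambda>v. \<alpha> v *\<^sub>R v"] sum.remove[OF fW w, of "\<lambda>v. \<beta> v *\<^sub>R v"] z by simp_all
      then show ?thesis unfolding inR using a b \<alpha>(2) \<beta>(2) by auto
    qed
    show "a \<in> R w" "b \<in> R w" if "a \<in> Q" "b \<in> Q" "y \<in> R w" "y \<in> open_segment a b" for a b y
      using *[OF that] by blast+
  qed
  have "\<exists>w\<in>W. x \<notin> R w"
  proof (rule ccontr)
    assume "\<not> (\<exists>w\<in>W. x \<notin> R w)"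
    then have xR: "x \<in> R w" if "w \<in> W" for w using that by blast
    have xL: "x \<notin> L" using x QL by blast
    have "W \<noteq> {}"
    proof
      assume "W = {}"
      then show False using QC x(1) xL by (auto simp: C_def)
    qed
    then obtain w where w: "w \<in> W" by blast
    \<comment> \<open>A single generator would put \<open>Q\<close> into the span of
      \<open>H\<close> and one point, against \<open>codim\<close>.\<close>
    have "W \<noteq> {w}"
    proof
      assume "W = {w}"
      then have "Q \<subseteq> span (insert w H)"
        using QC by (fastforce simp: C_def L_def span_breakdown_eq)
      then show False using codim w W VQ by blast
    qed
    then obtain w' where w': "w' \<in> W" "w' \<noteq> w" using w by blast
    obtain k where k: "x - k *\<^sub>R w \<in> L" using xR[OF w] inR by blast
    obtain k' where k': "x - k' *\<^sub>R w' \<in> L" using xR[OF w'(1)] inR by blast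
    have nz: "k \<noteq> 0" "k' \<noteq> 0" using k k' xL by auto
    \<comment> \<open>Modulo \<open>L\<close>, \<open>x\<close> is both \<open>k w\<close> and
      \<open>k' w'\<close>, so \<open>w\<close> is \<open>r w'\<close>. For \<open>r \<ge> 0\<close>
      this contradicts \<open>irr\<close>; for \<open>r < 0\<close> it gives a non-trivial
      non-negative combination in \<open>L\<close>, contrary to \<open>pointed\<close>.\<close>
    define r where "r = k' / k"
    have "w - r *\<^sub>R w' = (1/k) *\<^sub>R ((x - k' *\<^sub>R w') - (x - k *\<^sub>R w))"
      using nz by (simp add: r_def scaleR_diff_right)
    then have rL: "w - r *\<^sub>R w' \<in> L" by (simp only: Lscale Ldiff k k')
    show False
    proof (cases "r \<ge> 0")
      case True
      have "(\<Sum>v\<in>W-{w}. (if v = w' then r else 0) *\<^sub>R v) = (\<Sum>v\<in>W-{w}. if w' = v then r *\<^sub>R v else 0)"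
        by (rule sum.cong) auto
      then have "(\<Sum>v\<in>W-{w}. (if v = w' then r else 0) *\<^sub>R v) = r *\<^sub>R w'"
        using w' fW by simp
      then have "w \<in> C (W - {w})"
        unfolding C_def using rL True by (auto intro!: exI[of _ "\<lambda>v. if v = w' then r else 0"] split: if_splits)
      then show False using irr w by blast
    next
      case False
      define u where "u v = (if v = w then 1 else if v = w' then - r else 0)" for v
      have "(\<Sum>v\<in>W. u v *\<^sub>R v) = (\<Sum>v\<in>W. (if w = v then v else 0) - (if w' = v then r *\<^sub>R v else 0))"
        by (rule sum.cong) (use w' in \<open>auto simp: u_def\<close>)
      then have "(\<Sum>v\<in>W. u v *\<^sub>R v) = w - r *\<^sub>R w'"
        using w w' fW by (simp add: sum_subtractf)
      then have "u w = 0"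
        by (intro pointed) (use rL False w in \<open>auto simp: u_def\<close>)
      then show False by (simp add: u_def)
    qed
  qed
  then obtain w where w: "w \<in> W" "x \<notin> R w" by blast
  have "w \<notin> H" using WL[OF w(1)] span_base[of w H] by (auto simp: L_def)
  then show ?thesis using face[OF w(1)] HR[of w] wR[OF w(1)] w(2) by blast
qed

text \<open>Translating a point of \<open>H\<close> to the origin turns the affine hulls of sets
  containing it into linear spans, which reduces the claim to
  \<open>ex_face_of_avoiding_0\<close>.\<close>

lemma ex_face_of_avoiding:
  fixes Q :: "'a::real_vector set"
  assumes Q: "polytope Q" and H: "H face_of Q" "H \<noteq> {}" and x: "x \<in> Q" "x \<notin> H"
    and codim: "\<And>w. w \<in> Q \<Longrightarrow> \<not> Q \<subseteq> affine hull (insert w H)"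
  shows "\<exists>H'. H' face_of Q \<and> H \<subset> H' \<and> x \<notin> H'"
proof -
  obtain a where a: "a \<in> H" using H by blast
  let ?t = "(+) (- a)"
  have inv: "(+) a ` ?t ` X = X" for X by (simp add: image_image)
  have z: "0 \<in> ?t ` H" using a by force
  have "\<exists>K. K face_of ?t ` Q \<and> ?t ` H \<subset> K \<and> ?t x \<notin> K"
  proof (rule ex_face_of_avoiding_0)
    show "polytope (?t ` Q)" using Q by (simp only: polytope_translation_eq)
    show "?t ` H face_of ?t ` Q" using H by (simp only: face_of_translation_eq)
    show "0 \<in> ?t ` H" by (rule z)
    show "?t x \<in> ?t ` Q" "?t x \<notin> ?t ` H" using x by auto
    fix w assume "w \<in> ?t ` Q"
    then obtain q where q: "q \<in> Q" "w = ?t q" by blast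
    have "0 \<in> affine hull (insert w (?t ` H))" using z by (simp add: hull_inc)
    then have "span (insert w (?t ` H)) = ?t ` (affine hull (insert q H))"
      using affine_hull_span_0[of "insert w (?t ` H)"] q affine_hull_translation[of "-a" "insert q H"]
      by simp
    then show "\<not> ?t ` Q \<subseteq> span (insert w (?t ` H))"
      using codim[OF q(1)] by (auto simp: image_iff subset_iff)
  qed
  then obtain K where K: "K face_of ?t ` Q" "?t ` H \<subset> K" "?t x \<notin> K" by blast
  have Keq: "?t ` (+) a ` K = K" by (simp add: image_image)
  then have "(+) a ` K face_of Q" using K(1) face_of_translation_eq[of "-a" "(+) a ` K" Q] by simp
  moreover have "H \<subset> (+) a ` K"
  proof
    show "H \<subseteq> (+) a ` K"
      by (subst inv[of H, symmetric]) (rule image_mono[OF psubset_imp_subset[OF K(2)]])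
    show "H \<noteq> (+) a ` K" using K(2) Keq by (metis psubset_eq)
  qed
  moreover have "x \<notin> (+) a ` K" using K(3) by auto
  ultimately show ?thesis by blast
qed

text \<open>Among the finitely many faces that contain \<open>G\<close> and avoid \<open>x\<close>,
  a maximal one cannot be enlarged, so by \<open>ex_face_of_avoiding\<close> one point completes it
  to the affine hull. Hence the points of \<open>Q\<close> common to all facets that contain
  \<open>G\<close> form exactly \<open>G\<close>.\<close>

lemma ex_facet_avoiding:
  fixes Q :: "'a::real_vector set"
  assumes Q: "polytope Q" and G: "G face_of Q" "G \<noteq> {}" and x: "x \<in> Q" "x \<notin> G"
  obtains H where "H \<in> facets Q" "G \<subseteq> H" "x \<notin> H"
proof -
  define A where "A = {H. H face_of Q \<and> G \<subseteq> H \<and> x \<notin> H}"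
  have "finite A" using finite_faces_polytope[OF Q] by (rule rev_finite_subset) (auto simp: A_def)
  moreover have "G \<in> A" using G x by (simp add: A_def)
  ultimately obtain H where "H \<in> A" and max: "\<forall>H'\<in>A. H \<subseteq> H' \<longrightarrow> H = H'"
    using finite_has_maximal[of A] by blast
  then have H: "H face_of Q" "G \<subseteq> H" "x \<notin> H" by (simp_all add: A_def)
  have "\<not> (\<exists>H'. H' face_of Q \<and> H \<subset> H' \<and> x \<notin> H')"
    using max H(2) by (auto simp: A_def)
  then have "\<exists>w\<in>Q. Q \<subseteq> affine hull (insert w H)"
    using ex_face_of_avoiding[OF Q H(1) _ x(1) H(3)] H(2) G(2) by auto
  then obtain w where w: "w \<in> Q" "Q \<subseteq> affine hull (insert w H)" by blast
  \<comment> \<open>Otherwise \<open>x\<close> would lie in the affine hull of \<open>H\<close>,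
    hence in \<open>H\<close>.\<close>
  have "w \<notin> H"
  proof
    assume "w \<in> H"
    then have "x \<in> affine hull H" using w(2) x(1) by (auto simp: insert_absorb)
    then show False using mem_face_of_affine_hull[OF H(1) x(1)] H(3) by simp
  qed
  moreover have "H \<noteq> {}" using H(2) G(2) by auto
  ultimately have "H \<in> facets Q" using facets_iff_affine_hull[OF Q, of H] H(1) w by auto
  then show ?thesis using that H(2,3) by simp
qed

section \<open>Facets as maximal proper faces; facets of faces, products and copies\<close>

lemma facetsD:
  fixes Q :: "'a::real_vector set"
  assumes "polytope Q" "F \<in> facets Q"
  shows "F face_of Q" "F \<noteq> {}" "F \<noteq> Q" "F \<subseteq> Q"
  using assms facets_iff_affine_hull[OF assms(1)] face_of_imp_subset by blast+

text \<open>If a face \<open>G\<close> contains \<open>F\<close> and a further point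
  \<open>y\<close>, Steinitz exchange puts \<open>y\<close> in place of the point \<open>w\<close>
  that completes \<open>F\<close>, so the affine hull of \<open>G\<close> contains \<open>Q\<close>
  and \<open>G = Q\<close>. Conversely, a maximal proper face coincides with any facet above it, and
  \<open>ex_facet_avoiding\<close> provides one.\<close>

lemma facets_iff_maximal:
  fixes Q :: "'a::real_vector set"
  assumes Q: "polytope Q"
  shows "F \<in> facets Q \<longleftrightarrow> F face_of Q \<and> F \<noteq> {} \<and> F \<noteq> Q \<and>
    (\<forall>G. G face_of Q \<and> F \<subseteq> G \<longrightarrow> G = F \<or> G = Q)" (is "?l \<longleftrightarrow> ?r")
proof
  assume l: ?l
  then obtain w where w: "w \<in> Q - F" "Q \<subseteq> affine hull (insert w F)"
    using facets_iff_affine_hull[OF Q] by blast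
  note F = facetsD[OF Q l]
  have "G = Q" if G: "G face_of Q" "F \<subseteq> G" "G \<noteq> F" for G
  proof -
    obtain y where y: "y \<in> G" "y \<notin> F" using G by blast
    have GQ: "G \<subseteq> Q" using G face_of_imp_subset by blast
    have yF: "y \<notin> affine hull F" using mem_face_of_affine_hull[OF F(1)] y GQ by blast
    have yw: "y \<in> affine hull (insert w F)" using w y GQ by blast
    obtain a where a: "a \<in> F" using F(2) by blast
    have hw: "affine hull (insert v F) = (+) a ` span (insert (-a + v) ((\<lambda>x. -a + x) ` F))" for v
      using affine_hull_insert_span_gen[of a "insert v F"] a by (simp add: insert_absorb insert_commute)
    have hF: "affine hull F = (+) a ` span ((\<lambda>x. -a + x) ` F)"
      using affine_hull_insert_span_gen[of a F] a by (simp add: insert_absorb)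
    let ?M = "(\<lambda>x. -a + x) ` F"
    have "-a + y \<in> span (insert (-a + w) ?M)" "-a + y \<notin> span ?M"
      using yw yF unfolding hw hF by (auto simp: image_iff)
    then have "-a + w \<in> span (insert (-a + y) ?M)" using in_span_insert by blast
    then have "a + (-a + w) \<in> affine hull (insert y F)" unfolding hw by blast
    then have "insert w F \<subseteq> affine hull (insert y F)" by (auto simp: hull_inc)
    then have "affine hull (insert w F) \<subseteq> affine hull (insert y F)" by (simp add: hull_minimal)
    also have "\<dots> \<subseteq> affine hull G" by (rule hull_mono) (use y G in auto)
    finally have "Q \<subseteq> affine hull G" using w by blast
    then show "G = Q" using mem_face_of_affine_hull[OF G(1)] GQ by blast
  qed
  then show ?r using F by blast
next
  assume r: ?r
  then obtain x where x: "x \<in> Q" "x \<notin> F" using face_of_imp_subset by blast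
  obtain H where H: "H \<in> facets Q" "F \<subseteq> H" "x \<notin> H"
    using ex_facet_avoiding[OF Q _ _ x] r by metis
  then have "H = F" using r facetsD[OF Q H(1)] by blast
  then show ?l using H by blast
qed

lemma finite_facets:
  fixes Q :: "'a::real_vector set"
  assumes "polytope Q"
  shows "finite (facets Q)"
  by (rule finite_subset[OF _ finite_faces_polytope[OF assms]]) (auto simp: facets_def)

text \<open>A facet \<open>H\<close> of \<open>Q\<close> above \<open>F\<close> that avoids a point
  of \<open>G - F\<close> meets \<open>G\<close> in a proper face of \<open>G\<close> containing
  \<open>F\<close>; by maximality this is \<open>F\<close>.\<close>

lemma facet_of_face:
  fixes Q :: "'a::real_vector set"
  assumes Q: "polytope Q" and G: "G face_of Q" and F: "F \<in> facets G"
  obtains H where "H \<in> facets Q" "F = G \<inter> H"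
proof -
  have pG: "polytope G" using polytope_face[OF Q G] .
  note F' = facetsD[OF pG F]
  have FQ: "F face_of Q" using face_of_trans[OF F'(1) G] .
  obtain x where x: "x \<in> G" "x \<notin> F" using F' by blast
  then have "x \<in> Q" using G face_of_imp_subset by blast
  then obtain H where H: "H \<in> facets Q" "F \<subseteq> H" "x \<notin> H"
    using ex_facet_avoiding[OF Q FQ F'(2)] x by metis
  have "G \<inter> H face_of G"
    using face_of_face[OF G] face_of_Int[OF G facetsD(1)[OF Q H(1)]] by blast
  then have "G \<inter> H = F"
    using facets_iff_maximal[OF pG, of F] F F' H x by blast
  then show ?thesis using that H by blast
qed

text \<open>A facet \<open>H\<close> of \<open>Q\<close> that contains or misses \<open>G\<close>
  has \<open>G \<inter> H\<close> equal to \<open>G\<close> or empty, and neither is a facet of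
  \<open>G\<close>. So every facet of \<open>G\<close> is cut out by one of the remaining facets of
  \<open>Q\<close>.\<close>

lemma card_facets_face_le:
  fixes Q :: "'a::real_vector set"
  assumes Q: "polytope Q" and G: "G face_of Q"
  shows "card (facets G) \<le> card {H \<in> facets Q. \<not> G \<subseteq> H \<and> G \<inter> H \<noteq> {}}"
proof (rule surj_card_le)
  show "finite {H \<in> facets Q. \<not> G \<subseteq> H \<and> G \<inter> H \<noteq> {}}" using finite_facets[OF Q] by simp
  show "facets G \<subseteq> (\<inter>) G ` {H \<in> facets Q. \<not> G \<subseteq> H \<and> G \<inter> H \<noteq> {}}"
  proof
    fix F assume F: "F \<in> facets G"
    obtain H where "H \<in> facets Q" "F = G \<inter> H" using facet_of_face[OF Q G F] .
    then show "F \<in> (\<inter>) G ` {H \<in> facets Q. \<not> G \<subseteq> H \<and> G \<inter> H \<noteq> {}}"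
      using facetsD(2,3)[OF polytope_face[OF Q G] F] by blast
  qed
qed

text \<open>A facet is a product of faces \<open>F\<close> and \<open>F'\<close>, and maximality
  allows only one proper factor: if \<open>F'\<close> is proper, then \<open>F \<times> T\<close> is
  strictly larger than the facet and hence the whole product, which gives
  \<open>F = S\<close>.\<close>

lemma facets_Times_subset:
  fixes S :: "'a::real_vector set" and T :: "'b::real_vector set"
  assumes S: "polytope S" and T: "polytope T"
  shows "facets (S \<times> T) \<subseteq> (\<lambda>F. F \<times> T) ` facets S \<union> (\<lambda>F. S \<times> F) ` facets T"
proof
  fix C assume C: "C \<in> facets (S \<times> T)"
  have ST: "polytope (S \<times> T)" using S T by (rule polytope_Times)
  note C' = facetsD[OF ST C]
  have cS: "S face_of S" "T face_of T"
    using S T by (simp_all add: face_of_refl polytope_imp_convex)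
  obtain F F' where F: "F face_of S" "F' face_of T" "C = F \<times> F'"
    using face_of_Times_cases[OF C'(1)] .
  have ne: "F \<noteq> {}" "F' \<noteq> {}" using F C' by auto
  have sub: "F \<subseteq> S" "F' \<subseteq> T" using F face_of_imp_subset by blast+
  have max: "G \<times> G' = F \<times> F' \<or> G \<times> G' = S \<times> T"
    if "G face_of S" "G' face_of T" "F \<subseteq> G" "F' \<subseteq> G'" for G G'
  proof -
    have "G \<times> G' face_of S \<times> T" using face_of_Times that by blast
    moreover have "C \<subseteq> G \<times> G'" using that F by blast
    ultimately show ?thesis using C facets_iff_maximal[OF ST] F by metis
  qed
  show "C \<in> (\<lambda>F. F \<times> T) ` facets S \<union> (\<lambda>F. S \<times> F) ` facets T"
  proof (cases "F' = T")
    case True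
    have FS: "F \<noteq> S" using True F C' by blast
    have "G = F \<or> G = S" if G: "G face_of S" "F \<subseteq> G" for G
      using max[OF G(1) F(2) G(2) subset_refl] True ne sub by (auto simp: times_eq_iff)
    then have "F \<in> facets S" using facets_iff_maximal[OF S] F FS ne by blast
    then show ?thesis using True F by blast
  next
    case False
    have "F = S"
      using max[OF F(1) cS(2) subset_refl sub(2)] False ne sub by (auto simp: times_eq_iff)
    moreover have "G = F' \<or> G = T" if G: "G face_of T" "F' \<subseteq> G" for G
      using max[OF F(1) G(1) subset_refl G(2)] \<open>F = S\<close> ne sub by (auto simp: times_eq_iff)
    then have "F' \<in> facets T" using facets_iff_maximal[OF T] F False ne by blast
    ultimately show ?thesis using F by blast
  qed
qed

text \<open>Faces are pulled back along \<open>g\<close> and, in the other direction, along its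
  inverse \<open>f\<close>, so maximality transfers from the image to \<open>S\<close>. It follows
  that a linear copy has no more facets than the original.\<close>

lemma facets_image_subset:
  fixes S :: "'a::real_vector set" and g :: "'a \<Rightarrow> 'b::real_vector"
  assumes S: "polytope S" and g: "linear g" and f: "linear f" and fg: "\<And>x. x \<in> S \<Longrightarrow> f (g x) = x"
  shows "facets (g ` S) \<subseteq> (`) g ` facets S"
proof
  have pg: "polytope (g ` S)" using polytope_linear_image[OF g S] .
  have cS: "convex S" "convex (g ` S)" using S pg by (simp_all add: polytope_imp_convex)
  fix F assume F: "F \<in> facets (g ` S)"
  note F' = facetsD[OF pg F]
  define G where "G = {x\<in>S. g x + 0 \<in> F}"
  have G: "G face_of S"
    unfolding G_def by (rule face_of_vimage_affine[OF g cS(1) _ F'(1)]) simp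
  have gG: "g ` G = F" using F'(4) by (auto simp: G_def)
  have "K = G \<or> K = S" if K: "K face_of S" "G \<subseteq> K" for K
  proof -
    have KS: "K \<subseteq> S" using K face_of_imp_subset by blast
    have "{y\<in>g ` S. f y + 0 \<in> K} face_of g ` S"
      by (rule face_of_vimage_affine[OF f cS(2) _ K(1)]) (use fg in auto)
    moreover have "{y\<in>g ` S. f y + 0 \<in> K} = g ` K" using fg KS by auto
    moreover have "F \<subseteq> g ` K" using gG K by blast
    ultimately have "g ` K = F \<or> g ` K = g ` S" using F facets_iff_maximal[OF pg] by auto
    moreover have "inj_on g S" using fg by (rule inj_on_inverseI)
    ultimately show ?thesis
      using KS gG inj_on_image_eq_iff[of g S K S] inj_on_image_eq_iff[of g S K G] G face_of_imp_subset by blast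
  qed
  moreover have "G \<noteq> S" "G \<noteq> {}" using gG F' by blast+
  ultimately have "G \<in> facets S" using facets_iff_maximal[OF S] G by blast
  then show "F \<in> (`) g ` facets S" using gG by blast
qed

subsection \<open>Extension complexity\<close>

lemma lookup_scaleR_real:
  "Poly_Mapping.lookup (r *\<^sub>R p) i = r * Poly_Mapping.lookup p i" for p :: "'k \<Rightarrow>\<^sub>0 real"
  by (simp add: scaleR_poly_mapping_def lookup_Abs_poly_mapping)

text \<open>The finitely many generators span a space with a finite basis \<open>B\<close>;
  \<open>g\<close> sends \<open>B\<close> injectively to unit sequences, and \<open>f\<close> reads
  the coordinates off again.\<close>

lemma polytope_copy:
  fixes S :: "'a::real_vector set"
  assumes "polytope S"
  obtains g :: "'a \<Rightarrow> nat \<Rightarrow>\<^sub>0 real" and f where "linear g" "linear f" "\<And>x. x \<in> S \<Longrightarrow> f (g x) = x"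
proof -
  obtain V where V: "finite V" "S = convex hull V" using assms unfolding polytope_def by blast
  obtain B where B: "B \<subseteq> V" "independent B" "V \<subseteq> span B"
    using maximal_independent_subset[of V] by blast
  have fB: "finite B" using B V finite_subset by blast
  obtain h :: "'a \<Rightarrow> nat" where h: "inj_on h B"
    using finite_imp_inj_to_nat_seg[OF fB] by blast
  obtain g :: "'a \<Rightarrow> nat \<Rightarrow>\<^sub>0 real" where g: "linear g" "\<And>b. b \<in> B \<Longrightarrow> g b = Poly_Mapping.single (h b) 1"
    using linear_independent_extend[OF B(2), of "\<lambda>b. Poly_Mapping.single (h b) 1"] by blast
  define f where "f p = (\<Sum>b\<in>B. Poly_Mapping.lookup p (h b) *\<^sub>R b)" for p :: "nat \<Rightarrow>\<^sub>0 real"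
  have f: "linear f"
    by (rule linearI)
      (simp_all add: f_def lookup_add lookup_scaleR_real scaleR_add_left sum.distrib scaleR_sum_right)
  have fgB: "f (g b) = b" if b: "b \<in> B" for b
  proof -
    have "f (g b) = (\<Sum>c\<in>B. if b = c then c else 0)"
      unfolding f_def g(2)[OF b]
      by (rule sum.cong) (use h b in \<open>auto simp: lookup_single when_def inj_on_def\<close>)
    then show ?thesis using b fB by simp
  qed
  have "(f \<circ> g) x = id x" if "x \<in> span B" for x
    by (rule linear_eq_on[OF linear_compose[OF g(1) f] linear_id that]) (simp add: fgB)
  moreover have "S \<subseteq> span B"
    unfolding V(2) by (rule hull_minimal[OF B(3)]) (simp add: subspace_imp_convex)
  ultimately show ?thesis using that[OF g(1) f] by auto
qed

lemma affine_image_of_trans: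
  assumes "affine_image_of P Q" "affine_image_of Q R"
  shows "affine_image_of P R"
proof -
  obtain f c where f: "linear f" "P = (\<lambda>x. f x + c) ` Q" using assms(1) unfolding affine_image_of_def by blast
  obtain g d where g: "linear g" "Q = (\<lambda>x. g x + d) ` R" using assms(2) unfolding affine_image_of_def by blast
  have "P = (\<lambda>x. (f \<circ> g) x + (f d + c)) ` R"
    unfolding f g by (simp add: image_image linear_add[OF f(1)] add.assoc)
  then show ?thesis using linear_compose[OF g(1) f(1)] unfolding affine_image_of_def by blast
qed

lemma affine_image_of_linear: "linear f \<Longrightarrow> affine_image_of (f ` Q) Q"
  unfolding affine_image_of_def by (intro exI[of _ f] exI[of _ 0]) simp

text \<open>A linear copy of \<open>Q\<close> among the finitely supported sequences still projects
  onto \<open>P\<close> and has at most as many facets. Extensions may therefore be built in any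
  real vector space, for instance as products.\<close>

lemma extension_complexity_le:
  fixes Q :: "'b::real_vector set"
  assumes Q: "polytope Q" and P: "affine_image_of P Q"
  shows "extension_complexity P \<le> card (facets Q)"
proof -
  obtain g :: "'b \<Rightarrow> nat \<Rightarrow>\<^sub>0 real" and f where gf: "linear g" "linear f" "\<And>x. x \<in> Q \<Longrightarrow> f (g x) = x"
    using polytope_copy[OF Q] by blast
  have pg: "polytope (g ` Q)" using polytope_linear_image[OF gf(1) Q] .
  have "f ` g ` Q = Q" using gf(3) by force
  then have "affine_image_of P (g ` Q)"
    using affine_image_of_trans[OF P] affine_image_of_linear[OF gf(2), of "g ` Q"] by simp
  then have "extension_complexity P \<le> card (facets (g ` Q))"
    unfolding extension_complexity_def by (intro Least_le) (use pg finite_facets[OF pg] in blast)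
  also have "\<dots> \<le> card (facets Q)"
    using facets_image_subset[OF Q gf] finite_facets[OF Q] by (rule surj_card_le[rotated])
  finally show ?thesis .
qed

lemma extension_complexity_attained:
  fixes P :: "'a::euclidean_space set"
  assumes "polytope P"
  obtains Q :: "(nat \<Rightarrow>\<^sub>0 real) set"
  where "polytope Q" "affine_image_of P Q" "card (facets Q) = extension_complexity P"
proof -
  have "\<exists>n. \<exists>Q :: (nat \<Rightarrow>\<^sub>0 real) set.
        polytope Q \<and> affine_image_of P Q \<and> finite (facets Q) \<and> card (facets Q) = n"
    using extension_exists[OF assms] finite_facets by blast
  from LeastI_ex[OF this] show ?thesis using that unfolding extension_complexity_def by blast
qed

section \<open>The upper and the lower bound for products\<close>

lemma card_facets_simplex_le:
  fixes C :: "'b::euclidean_space set"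
  assumes "\<not> affine_dependent C"
  shows "card (facets (convex hull C)) \<le> card C"
proof (rule surj_card_le)
  show "finite C" using assms by (rule aff_independent_finite)
  show "facets (convex hull C) \<subseteq> (\<lambda>u. convex hull (C - {u})) ` C"
    unfolding facets_eq_facet_of facet_of_convex_hull_affine_independent[OF assms] by auto
qed

lemma extension_complexity_Times_le:
  fixes P :: "'a::euclidean_space set" and D :: "'b::euclidean_space set"
  assumes P: "polytope P" and D: "polytope D"
  shows "extension_complexity (P \<times> D) \<le> extension_complexity P + card (facets D)"
proof -
  obtain Q :: "(nat \<Rightarrow>\<^sub>0 real) set" where Q: "polytope Q" "affine_image_of P Q"
    "card (facets Q) = extension_complexity P"
    using extension_complexity_attained[OF P] .
  obtain f c where f: "linear f" "P = (\<lambda>x. f x + c) ` Q"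
    using Q(2) unfolding affine_image_of_def by blast
  have QD: "polytope (Q \<times> D)" using Q(1) D by (rule polytope_Times)
  \<comment> \<open>Linear part of the map that projects the first coordinate from \<open>Q\<close>
    onto \<open>P\<close> and fixes the second.\<close>
  have "linear (\<lambda>z. (f (fst z), snd z))"
    by (rule linearI) (simp_all add: linear_add[OF f(1)] linear_scale[OF f(1)])
  moreover have "P \<times> D = (\<lambda>z. (f (fst z), snd z) + (c, 0)) ` (Q \<times> D)"
    unfolding f(2) by (force simp: image_iff)
  ultimately have "affine_image_of (P \<times> D) (Q \<times> D)"
    unfolding affine_image_of_def by blast
  then have "extension_complexity (P \<times> D) \<le> card (facets (Q \<times> D))"
    by (rule extension_complexity_le[OF QD])
  also have "\<dots> \<le> card ((\<lambda>F. F \<times> D) ` facets Q \<union> (\<lambda>F. Q \<times> F) ` facets D)"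
    by (rule card_mono[OF _ facets_Times_subset[OF Q(1) D]])
      (simp add: finite_facets Q(1) D)
  also have "\<dots> \<le> card ((\<lambda>F. F \<times> D) ` facets Q) + card ((\<lambda>F. Q \<times> F) ` facets D)"
    by (rule card_Un_le)
  also have "\<dots> \<le> card (facets Q) + card (facets D)"
    by (intro add_mono card_image_le finite_facets Q(1) D)
  finally show ?thesis using Q(3) by simp
qed

lemma extension_complexity_Times_simplex_ge:
  fixes P :: "'a::euclidean_space set" and C :: "'b::euclidean_space set"
  assumes P: "polytope P" "P \<noteq> {}" and C: "\<not> affine_dependent C" "card C \<ge> 2"
  shows "extension_complexity P + card C \<le> extension_complexity (P \<times> (convex hull C))"
proof -
  define D where "D = convex hull C"
  have fC: "finite C" using C(1) aff_independent_finite by blast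
  have pD: "polytope D" unfolding D_def by (rule polytope_convex_hull[OF fC])
  have pPD: "polytope (P \<times> D)" using P(1) pD by (rule polytope_Times)
  have CD: "C \<subseteq> D" unfolding D_def by (rule hull_subset)
  obtain Q :: "(nat \<Rightarrow>\<^sub>0 real) set" where Q: "polytope Q" "affine_image_of (P \<times> D) Q"
    "card (facets Q) = extension_complexity (P \<times> D)"
    using extension_complexity_attained[OF pPD] .
  obtain f c where f: "linear f" and PD: "P \<times> D = (\<lambda>x. f x + c) ` Q"
    using Q(2) unfolding affine_image_of_def by blast
  have cQ: "convex Q" using Q(1) by (rule polytope_imp_convex)
  have fQ: "finite (facets Q)" using Q(1) by (rule finite_facets)
  have PP: "P face_of P" using P(1) by (simp add: face_of_refl polytope_imp_convex)
  define R where "R v = {q\<in>Q. f q + c \<in> P \<times> {v}}" for v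
  define G where "G v = {q\<in>Q. f q + c \<in> P \<times> (convex hull (C - {v}))}" for v
  have Rface: "R v face_of Q" if "v \<in> C" for v
  proof -
    have "{v} face_of D"
      unfolding D_def face_of_convex_hull_affine_independent[OF C(1)]
      using that by (intro exI[of _ "{v}"]) simp
    then have "P \<times> {v} face_of P \<times> D" by (rule face_of_Times[OF PP])
    then show ?thesis unfolding R_def
      by (rule face_of_vimage_affine[OF f cQ, rotated]) (simp add: PD)
  qed
  have Gface: "G v face_of Q" for v
  proof -
    have "convex hull (C - {v}) face_of D"
      unfolding D_def face_of_convex_hull_affine_independent[OF C(1)]
      by (intro exI[of _ "C - {v}"]) simp
    then have "P \<times> (convex hull (C - {v})) face_of P \<times> D" by (rule face_of_Times[OF PP])
    then show ?thesis unfolding G_def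
      by (rule face_of_vimage_affine[OF f cQ, rotated]) (simp add: PD)
  qed
  have lift: "\<exists>q\<in>R v. f q + c = (p, v)" if "p \<in> P" "v \<in> C" for p v
  proof -
    have "(p, v) \<in> (\<lambda>x. f x + c) ` Q" using that CD PD by auto
    then obtain q where "q \<in> Q" "f q + c = (p, v)" by auto
    then show ?thesis using that by (auto simp: R_def)
  qed
  have Rne: "R v \<noteq> {}" if "v \<in> C" for v using lift that P(2) by blast
  \<comment> \<open>A vertex \<open>u\<close> other than \<open>v\<close> belongs to the hull of the
    vertices other than \<open>v\<close>.\<close>
  have RG: "R u \<subseteq> G v" if "u \<in> C" "u \<noteq> v" for u v
    using that hull_inc[of u "C - {v}" convex] by (auto simp: R_def G_def)
  have RGdisj: "R v \<inter> G v = {}" if "v \<in> C" for v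
  proof -
    have "v \<notin> convex hull (C - {v})"
      using C(1) that convex_hull_subset_affine_hull[of "C - {v}"] unfolding affine_dependent_def by auto
    then show ?thesis by (auto simp: R_def G_def)
  qed
  \<comment> \<open>Here two vertices are needed: if \<open>v\<close> were the only one,
    \<open>G v\<close> would be empty.\<close>
  have other: "\<exists>w\<in>C. w \<noteq> v" for v
  proof (rule ccontr)
    assume "\<not> (\<exists>w\<in>C. w \<noteq> v)"
    then have "C \<subseteq> {v}" by auto
    then have "card C \<le> card {v}" by (intro card_mono) auto
    then show False using C(2) by simp
  qed
  have Gne: "G v \<noteq> {}" for v using other[of v] RG Rne by blast
  \<comment> \<open>otherwise the facet would be a smaller extension\<close>
  have noall: "\<not> (\<forall>w\<in>C. R w \<subseteq> H)" if H: "H \<in> facets Q" for H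
  proof
    assume all: "\<forall>w\<in>C. R w \<subseteq> H"
    note H' = facetsD[OF Q(1) H]
    have pH: "polytope H" using polytope_face[OF Q(1) H'(1)] .
    define X where "X = (\<lambda>x. f x + c) ` H"
    have "X = (+) c ` f ` H" unfolding X_def by (auto simp: image_image add.commute)
    then have cX: "convex X"
      using convex_linear_image[OF f polytope_imp_convex[OF pH]] by (simp add: convex_translation)
    have "(p, d) \<in> X" if "p \<in> P" "d \<in> D" for p d
    proof -
      \<comment> \<open>The fibre of \<open>X\<close> over \<open>p\<close> is convex and contains
        every vertex of \<open>D\<close>, hence all of \<open>D\<close>.\<close>
      have "convex {d. (p, d) \<in> X}"
        unfolding convex_def
      proof (intro ballI allI impI CollectI)
        fix x y and s t :: real
        assume xy: "x \<in> {d. (p, d) \<in> X}" "y \<in> {d. (p, d) \<in> X}" and st: "0 \<le> s" "0 \<le> t" "s + t = 1"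
        then have "s *\<^sub>R (p, x) + t *\<^sub>R (p, y) \<in> X"
          by (intro convexD[OF cX]) simp_all
        then show "(p, s *\<^sub>R x + t *\<^sub>R y) \<in> X"
          using st by (simp add: scaleR_left_distrib[symmetric])
      qed
      moreover have "C \<subseteq> {d. (p, d) \<in> X}"
      proof
        fix v assume v: "v \<in> C"
        obtain q where "q \<in> R v" "f q + c = (p, v)" using lift[OF \<open>p \<in> P\<close> v] by blast
        then show "v \<in> {d. (p, d) \<in> X}" using all v unfolding X_def by (auto intro!: image_eqI[of _ _ q])
      qed
      ultimately have "D \<subseteq> {d. (p, d) \<in> X}" unfolding D_def by (simp add: hull_minimal)
      then show ?thesis using \<open>d \<in> D\<close> by auto
    qed
    moreover have "X \<subseteq> P \<times> D" unfolding X_def PD using H'(4) by (rule image_mono)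
    ultimately have "P \<times> D = X" by auto
    then have "affine_image_of (P \<times> D) H" unfolding affine_image_of_def X_def using f by blast
    then have "extension_complexity (P \<times> D) \<le> card (facets H)" by (rule extension_complexity_le[OF pH])
    also have "\<dots> \<le> card {K \<in> facets Q. \<not> H \<subseteq> K \<and> H \<inter> K \<noteq> {}}"
      by (rule card_facets_face_le[OF Q(1) H'(1)])
    \<comment> \<open>The inequality is strict because the facet \<open>H\<close> contains itself
      and is not counted on the left.\<close>
    also have "\<dots> < card (facets Q)"
      by (rule psubset_card_mono[OF fQ]) (use H in auto)
    finally show False using Q(3) by simp
  qed
  define N where "N v = {H \<in> facets Q. G v \<subseteq> H}" for v
  have fN: "finite (N v)" for v using fQ by (simp add: N_def)
  have Ndisj: "N u \<inter> N v = {}" if "u \<noteq> v" for u v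
  proof (rule ccontr)
    assume "N u \<inter> N v \<noteq> {}"
    then obtain H where H: "H \<in> facets Q" "G u \<subseteq> H" "G v \<subseteq> H" by (auto simp: N_def)
    \<comment> \<open>Every vertex \<open>w\<close> differs from \<open>u\<close> or from
      \<open>v\<close>, so \<open>R w\<close> lies in \<open>G u\<close> or in
      \<open>G v\<close>.\<close>
    have "R w \<subseteq> H" if w: "w \<in> C" for w
    proof (cases "w = u")
      case True
      then show ?thesis using RG[OF w, of v] H(3) \<open>u \<noteq> v\<close> by blast
    next
      case False
      then show ?thesis using RG[OF w, of u] H(2) by blast
    qed
    then show False using noall[OF H(1)] by blast
  qed
  \<comment> \<open>The points of \<open>R v\<close> are outside \<open>G v\<close>, so
    \<open>G v\<close> is a proper face and lies in a facet.\<close>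
  have N1: "card (N v) \<ge> 1" if v: "v \<in> C" for v
  proof -
    obtain x where x: "x \<in> R v" using Rne[OF v] by blast
    then have "x \<in> Q" "x \<notin> G v" using RGdisj[OF v] by (auto simp: R_def)
    then obtain H where "H \<in> facets Q" "G v \<subseteq> H"
      using ex_facet_avoiding[OF Q(1) Gface Gne] by metis
    then have "N v \<noteq> {}" by (auto simp: N_def)
    then show ?thesis using fN by (simp add: Suc_le_eq card_gt_0_iff)
  qed
  have cardU: "card (\<Union>v\<in>I. N v) = (\<Sum>v\<in>I. card (N v))" if "I \<subseteq> C" for I
    using Ndisj fN finite_subset[OF that fC] by (intro card_UN_disjoint) auto
  \<comment> \<open>The second coordinate is constant on the image of \<open>R i\<close>, so the
    first one projects \<open>R i\<close> onto \<open>P\<close>. Facets of \<open>Q\<close> in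
    \<open>U\<close> cut out no facet of \<open>R i\<close>, which leaves at most
    \<open>card (facets Q) - card U\<close> facets of \<open>R i\<close>.\<close>
  have key: ?thesis
    if i: "i \<in> C" and U: "U \<subseteq> facets Q" "card C \<le> card U"
      and useless: "\<And>H. H \<in> U \<Longrightarrow> R i \<subseteq> H \<or> R i \<inter> H = {}" for i U
  proof -
    have pR: "polytope (R i)" using polytope_face[OF Q(1) Rface[OF i]] .
    have "P = (\<lambda>x. (fst \<circ> f) x + fst c) ` R i"
    proof
      show "P \<subseteq> (\<lambda>x. (fst \<circ> f) x + fst c) ` R i"
      proof
        fix p assume "p \<in> P"
        then obtain q where "q \<in> R i" "f q + c = (p, i)" using lift i by blast
        then show "p \<in> (\<lambda>x. (fst \<circ> f) x + fst c) ` R i"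
          by (intro image_eqI[of _ _ q]) (auto dest: arg_cong[of _ _ fst])
      qed
    qed (auto simp: R_def mem_Times_iff)
    moreover have "linear (fst \<circ> f)" using f linear_fst by (rule linear_compose)
    ultimately have "affine_image_of P (R i)" unfolding affine_image_of_def by blast
    then have "extension_complexity P \<le> card (facets (R i))" by (rule extension_complexity_le[OF pR])
    also have "\<dots> \<le> card {K \<in> facets Q. \<not> R i \<subseteq> K \<and> R i \<inter> K \<noteq> {}}"
      by (rule card_facets_face_le[OF Q(1) Rface[OF i]])
    also have "\<dots> \<le> card (facets Q - U)"
      by (rule card_mono) (use fQ useless in auto)
    also have "\<dots> = card (facets Q) - card U"
      using U(1) by (rule card_Diff_subset[OF finite_subset[OF U(1) fQ]])
    finally have "extension_complexity P \<le> card (facets Q) - card U" .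
    moreover have "card U \<le> card (facets Q)" using fQ U(1) by (rule card_mono)
    ultimately have "extension_complexity P + card C \<le> card (facets Q)" using U(2) by linarith
    then show ?thesis using Q(3) by (simp add: D_def)
  qed
  show ?thesis
  proof (cases "\<exists>j\<in>C. card (N j) \<ge> 2")
    case True
    then obtain j where j: "j \<in> C" "card (N j) \<ge> 2" by blast
    obtain i where i: "i \<in> C" "i \<noteq> j" using other by blast
    have "card C = card (C - {i}) + 1" using card.remove[OF fC i(1)] by simp
    \<comment> \<open>The second facet in \<open>N j\<close> makes up for the omitted vertex
      \<open>i\<close>.\<close>
    also have "\<dots> = (\<Sum>v\<in>C-{i}. 1 + (if j = v then 1 else 0))"
      using fC i j by (simp only: sum.distrib sum.delta finite_Diff) simp
    also have "\<dots> \<le> (\<Sum>v\<in>C-{i}. card (N v))"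
      by (rule sum_mono) (use N1 j in auto)
    also have "\<dots> = card (\<Union>v\<in>C-{i}. N v)" by (rule cardU[symmetric]) blast
    finally show ?thesis
    proof (rule key[OF i(1), rotated])
      show "(\<Union>v\<in>C-{i}. N v) \<subseteq> facets Q" by (auto simp: N_def)
      fix H assume "H \<in> (\<Union>v\<in>C-{i}. N v)"
      then obtain v where "v \<in> C" "i \<noteq> v" "G v \<subseteq> H" by (auto simp: N_def)
      then show "R i \<subseteq> H \<or> R i \<inter> H = {}" using RG[OF i(1)] by blast
    qed
  next
    case False
    then have one: "card (N v) = 1" if "v \<in> C" for v using N1[OF that] that by force
    obtain i where i: "i \<in> C" using other by blast
    obtain H0 where H0: "N i = {H0}" using one[OF i] card_1_singletonE by blast
    \<comment> \<open>\<open>G i\<close> is the set of points of \<open>Q\<close> common to the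
      facets containing it, and \<open>H0\<close> is the only such facet.\<close>
    have H0G: "H0 \<subseteq> G i"
    proof
      fix x assume x: "x \<in> H0"
      have "H0 \<in> facets Q" using H0 by (auto simp: N_def)
      then have xQ: "x \<in> Q" using facetsD(4)[OF Q(1)] x by blast
      show "x \<in> G i"
      proof (rule ccontr)
        assume nx: "x \<notin> G i"
        obtain H where "H \<in> facets Q" "G i \<subseteq> H" "x \<notin> H"
          using ex_facet_avoiding[OF Q(1) Gface Gne xQ nx] .
        then have "H \<in> N i" by (simp add: N_def)
        then show False using H0 x \<open>x \<notin> H\<close> by simp
      qed
    qed
    have "card C = (\<Sum>v\<in>C. card (N v))" using one by simp
    also have "\<dots> = card (\<Union>v\<in>C. N v)" by (rule cardU[symmetric]) blast
    finally have "card C \<le> card (\<Union>v\<in>C. N v)" by simp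
    then show ?thesis
    proof (rule key[OF i, rotated])
      show "(\<Union>v\<in>C. N v) \<subseteq> facets Q" by (auto simp: N_def)
      fix H assume "H \<in> (\<Union>v\<in>C. N v)"
      then obtain v where v: "v \<in> C" "H \<in> N v" by blast
      show "R i \<subseteq> H \<or> R i \<inter> H = {}"
      \<comment> \<open>For \<open>v = i\<close> the facet is \<open>H0\<close>, which lies in
        \<open>G i\<close> and so misses \<open>R i\<close>; in the other case it contains
        \<open>G v\<close> and with it \<open>R i\<close>.\<close>
      proof (cases "v = i")
        case True
        then show ?thesis using v(2) H0 H0G RGdisj[OF i] by blast
      next
        case False
        then show ?thesis using v(2) RG[OF i, of v] by (auto simp: N_def)
      qed
    qed
  qed
qed

theorem corollary2p4:
  fixes P :: "'a::euclidean_space set" and D :: "'b::euclidean_space set" and k :: nat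
  assumes "polytope P" and "P \<noteq> {}"
    and "k \<ge> 1"
    and "int k simplex D"
  shows "extension_complexity (P \<times> D) = extension_complexity P + k + 1"
proof -
  obtain C where C: "\<not> affine_dependent C" "int (card C) = int k + 1" "D = convex hull C"
    using assms(4) unfolding simplex by blast
  have cC: "card C = k + 1" using C(2) by linarith
  have "extension_complexity (P \<times> D) \<le> extension_complexity P + card (facets D)"
    using assms(1) simplex_imp_polytope[OF assms(4)] by (rule extension_complexity_Times_le)
  \<comment> \<open>The same number \<open>k + 1\<close> bounds the facets of \<open>D\<close> in
    the upper estimate and counts its vertices in the lower one.\<close>
  moreover have "card (facets D) \<le> k + 1"
    using card_facets_simplex_le[OF C(1)] C(3) cC by simp
  moreover have "extension_complexity P + card C \<le> extension_complexity (P \<times> D)"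
    unfolding C(3) using extension_complexity_Times_simplex_ge[OF assms(1,2) C(1)] cC assms(3) by simp
  ultimately show ?thesis using cC by linarith
qed

end
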